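(* Let $C$ be a simple closed $C^2$ curve in $\mathbb{R}^2$ bounding a compact Jordan domain $R$, and let $P$ be a point interior to $R$. If there exists a $C^2$ Morse function $f:R\to[0,1]$ such that $f^{-1}(0)=\{P\}$, $f^{-1}(1)=C$, and, for each $t\in(0,1]$, $f^{-1}(t)$ is a simple closed curve on which $|\nabla f|$ equals a positive constant (possibly depending on $t$), then $C$ is a circle.
   Context: A Morse function is a real-valued $C^2$ function all of whose critical points are nondegenerate (nonsingular Hessian). A compact Jordan domain bounded by $C$ is the union of $C$ and the bounded component of its complement. *)

theory Defs
  imports "HOL-Analysis.Analysis"
begin

text \<open>
  Derivatives of a function on a set \<open>S\<close> are taken within \<open>S\<close>, so that they depend only on the
  values on \<open>S\<close> and make sense on a closed domain. They are uniquely determined if \<open>S\<close> is open or is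
  a closed plane domain bounded by a regular \<open>C\<^sup>2\<close> curve; then the choice made by
  \<^const>\<open>frechet_derivative\<close> is immaterial.
\<close>

definition gradient :: "(real^'n \<Rightarrow> real) \<Rightarrow> (real^'n) set \<Rightarrow> real^'n \<Rightarrow> real^'n" where
  "gradient f S x = (\<chi> i. frechet_derivative f (at x within S) (axis i 1))"

definition hessian :: "(real^'n \<Rightarrow> real) \<Rightarrow> (real^'n) set \<Rightarrow> real^'n \<Rightarrow> real^'n^'n" where
  "hessian f S x = matrix (frechet_derivative (gradient f S) (at x within S))"

definition C2_on :: "(real^'n) set \<Rightarrow> (real^'n \<Rightarrow> real) \<Rightarrow> bool" where
  "C2_on S f \<longleftrightarrow>
     f differentiable_on S \<and> gradient f S differentiable_on S \<and> continuous_on S (hessian f S)"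

definition morse_on :: "(real^'n) set \<Rightarrow> (real^'n \<Rightarrow> real) \<Rightarrow> bool" where
  "morse_on S f \<longleftrightarrow>
     C2_on S f \<and> (\<forall>x\<in>S. gradient f S x = 0 \<longrightarrow> invertible (hessian f S x))"

definition simple_closed_curve :: "(real^2) set \<Rightarrow> bool" where
  "simple_closed_curve C \<longleftrightarrow>
     (\<exists>c. simple_path c \<and> pathfinish c = pathstart c \<and> path_image c = C)"

text \<open>
  A \<open>C\<^sup>2\<close> curve is understood to be regular (nowhere vanishing velocity). The parametrization is
  1-periodic on the whole line, so that it also closes up to second order; \<^const>\<open>simple_path\<close>
  and \<^const>\<open>path_image\<close> refer to its restriction to the unit interval.
\<close>

definition C2_simple_closed_curve :: "(real^2) set \<Rightarrow> bool" where
  "C2_simple_closed_curve C \<longleftrightarrow>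
     (\<exists>c c' c''. (\<forall>s. c (s + 1) = c s)
        \<and> (\<forall>s. (c has_vector_derivative c' s) (at s))
        \<and> (\<forall>s. (c' has_vector_derivative c'' s) (at s))
        \<and> continuous_on UNIV c''
        \<and> (\<forall>s. c' s \<noteq> 0)
        \<and> simple_path c \<and> path_image c = C)"

definition bounds_Jordan_domain :: "(real^2) set \<Rightarrow> (real^2) set \<Rightarrow> bool" where
  "bounds_Jordan_domain C R \<longleftrightarrow> (\<exists>B\<in>components (- C). bounded B \<and> R = C \<union> B)"

end

theory Submission
  imports Defs
begin

text \<open>
  Where \<open>|\<nabla>f| = g \<circ> f\<close>, the function \<open>u = h \<circ> f\<close> with \<open>h' = 1 / g\<close> solves the eikonal equation
  \<open>|\<nabla>u| = 1\<close>, so it should be the distance to \<open>P\<close> up to a constant, and the level sets of \<open>f\<close> should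
  be spheres about \<open>P\<close>. The classical argument follows the integral curves of \<open>\<nabla>u\<close>, which are straight
  segments. Here these curves are replaced by extremum arguments.

  As \<open>\<nabla>f\<close> vanishes at the minimum \<open>P\<close>, \<open>1 / g\<close> blows up near \<open>0\<close>. So take \<open>h t = width a t = \<integral>\<^sub>a\<^sup>t 1 / g\<close> with a cutoff \<open>a > 0\<close>, and let \<open>D\<close> be the
  largest distance from \<open>P\<close> within \<open>{f \<le> a}\<close>. On the open domain,
  \<open>width a (f x) \<le> dist P x \<le> width a (f x) + D\<close>.

  \<^item> Upper bound (\<open>dist_le_width\<close>): for \<open>c < 1\<close> the function \<open>u - c * dist P\<close> decreases when one steps
    along \<open>- \<nabla>u\<close>, because \<open>u\<close> drops at unit speed and the distance changes at most at unit speed. Such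
    a step stays in a sublevel set, so the minimum over \<open>{a \<le> f \<le> f x}\<close> lies on \<open>{f = a}\<close>.

  \<^item> Lower bound (\<open>width_le_dist\<close>): for \<open>c > 1\<close> the function \<open>u - c * dist P\<close> increases when one steps
    straight towards \<open>P\<close>. Such a step stays in a ball about \<open>P\<close>. Taking the ball that just touches the
    level set of \<open>x\<close>, its maximum over \<open>{a \<le> f}\<close> again lies on \<open>{f = a}\<close>.

  Both bounds extend by continuity to the boundary, where \<open>f = 1\<close>. Hence the distances from \<open>P\<close> to two
  boundary points differ by at most \<open>D\<close>, and \<open>D \<rightarrow> 0\<close> as \<open>a \<rightarrow> 0\<close> because \<open>P\<close> is the only zero of \<open>f\<close>
  (\<open>dist_frontier_le\<close>). So the boundary lies on a sphere about \<open>P\<close>. A bounded open set containing \<open>P\<close>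
  with such a boundary is the ball, as neither the ball nor the exterior of the sphere can meet
  the set without being contained in it (\<open>open_eq_ball_if_frontier_subset_sphere\<close>). For a Jordan
  domain the boundary is all of \<open>C\<close>, by the Jordan-Brouwer separation theorem.
\<close>

section \<open>Functions whose gradient norm is constant on level sets\<close>

text \<open>
  The gradient is taken in the open set \<open>B\<close>, where \<open>f\<close> has two-sided derivatives. On the frontier, \<open>G\<close>
  stands for its continuous extension.
\<close>

locale transnormal =
  fixes B :: "'a::euclidean_space set" and P :: 'a and f :: "'a \<Rightarrow> real"
    and G :: "'a \<Rightarrow> 'a" and g :: "real \<Rightarrow> real"
  assumes open_B: "open B" and bounded_B: "bounded B" and P_in_B: "P \<in> B"
    and cont_f: "continuous_on (closure B) f"
    and cont_G: "continuous_on (closure B) G"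
    and deriv_f: "\<And>x. x \<in> B \<Longrightarrow> (f has_derivative (\<lambda>v. G x \<bullet> v)) (at x)"
    and range_f: "f ` closure B = {0..1}"
    and f_eq_0_iff: "\<And>x. x \<in> closure B \<Longrightarrow> f x = 0 \<longleftrightarrow> x = P"
    and f_eq_1_iff: "\<And>x. x \<in> closure B \<Longrightarrow> f x = 1 \<longleftrightarrow> x \<in> frontier B"
    and norm_G: "\<And>x. x \<in> closure B \<Longrightarrow> x \<noteq> P \<Longrightarrow> norm (G x) = g (f x)"
    and g_pos: "\<And>t. 0 < t \<Longrightarrow> t \<le> 1 \<Longrightarrow> 0 < g t"
begin

definition width :: "real \<Rightarrow> real \<Rightarrow> real" where
  "width a t = integral {a..t} (\<lambda>s. 1 / g s)"

lemma compact_closure_B: "compact (closure B)"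
  using bounded_B by (simp add: compact_closure)

lemma f_range: "0 \<le> f x" "f x \<le> 1" if "x \<in> closure B"
  using range_f that by force+

lemma f_less_1: "f x < 1" if "x \<in> B"
proof -
  have "x \<in> closure B" "x \<notin> frontier B"
    using that open_B by (auto simp: frontier_def interior_open closure_subset[THEN subsetD])
  then show ?thesis
    using f_eq_1_iff f_range(2) by (metis less_eq_real_def)
qed

lemma in_B_if_less_1: "x \<in> B" if "x \<in> closure B" "f x < 1"
proof -
  have "x \<notin> frontier B" using that f_eq_1_iff[of x] by auto
  then show ?thesis using that open_B by (auto simp: frontier_def interior_open)
qed

lemma isCont_f: "isCont f x" if "x \<in> B"
  using deriv_f[OF that] has_derivative_continuous by blast

lemma compact_f_between: "compact {x \<in> closure B. a \<le> f x \<and> f x \<le> b}"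
proof -
  have "closed (closure B \<inter> f -` {a..b})"
    using cont_f by (intro continuous_closed_preimage) auto
  then have "compact (closure B \<inter> (closure B \<inter> f -` {a..b}))"
    using compact_closure_B by (rule compact_Int_closed[rotated])
  moreover have "closure B \<inter> (closure B \<inter> f -` {a..b}) = {x \<in> closure B. a \<le> f x \<and> f x \<le> b}"
    by auto
  ultimately show ?thesis by simp
qed

text \<open>
  As a continuous surjection from a compact set, \<open>f\<close> is a closed map, so continuity of
  \<open>g \<circ> f = |G|\<close> descends to \<open>g\<close>.
\<close>

lemma continuous_on_g: "continuous_on {a..1} g" if "0 < a"
  unfolding continuous_on_closed_vimage[OF closed_atLeastAtMost]
proof (intro allI impI)
  fix F :: "real set" assume F: "closed F"
  define K where "K = {x \<in> closure B. a \<le> f x \<and> f x \<le> 1}"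
  have K: "compact K" "K \<subseteq> closure B"
    using compact_f_between unfolding K_def by auto
  have "closed (K \<inter> (\<lambda>x. norm (G x)) -` F)"
    using K F cont_G
    by (intro continuous_closed_preimage continuous_on_norm)
       (auto intro: continuous_on_subset compact_imp_closed)
  then have "compact (K \<inter> (K \<inter> (\<lambda>x. norm (G x)) -` F))"
    using K by (intro compact_Int_closed)
  then have "compact (f ` (K \<inter> (\<lambda>x. norm (G x)) -` F))"
    using K cont_f by (intro compact_continuous_image) (auto intro: continuous_on_subset)
  moreover have "f ` (K \<inter> (\<lambda>x. norm (G x)) -` F) = g -` F \<inter> {a..1}"
  proof -
    have *: "norm (G x) = g (f x)" if "x \<in> K" for x
      using that norm_G[of x] f_eq_0_iff[of x] \<open>0 < a\<close> by (auto simp: K_def)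
    have "f ` K = {a..1}"
    proof
      show "{a..1} \<subseteq> f ` K"
      proof
        fix t assume t: "t \<in> {a..1}"
        with \<open>0 < a\<close> have "t \<in> f ` closure B" by (simp add: range_f)
        with t show "t \<in> f ` K" by (auto simp: K_def)
      qed
    qed (auto simp: K_def)
    show ?thesis
    proof (intro equalityI subsetI)
      fix t assume t: "t \<in> g -` F \<inter> {a..1}"
      then obtain x where "x \<in> K" "t = f x" using \<open>f ` K = {a..1}\<close> by blast
      with t * show "t \<in> f ` (K \<inter> (\<lambda>x. norm (G x)) -` F)" by auto
    qed (use * \<open>f ` K = {a..1}\<close> in auto)
  qed
  ultimately show "closed (g -` F \<inter> {a..1})"
    by (simp add: compact_imp_closed)
qed

lemma continuous_on_inverse_g: "continuous_on {a..1} (\<lambda>s. 1 / g s)" if "0 < a"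
proof -
  have "g s \<noteq> 0" if "s \<in> {a..1}" for s
    using g_pos[of s] that \<open>0 < a\<close> by auto
  then show ?thesis
    using continuous_on_g[OF that] by (intro continuous_intros) auto
qed

lemma continuous_on_width: "continuous_on {a..1} (width a)" if "0 < a"
  using indefinite_integral_continuous_1[OF integrable_continuous_real[OF continuous_on_inverse_g[OF that]]]
  by (simp add: width_def[abs_def])

text \<open>
  Integrals over empty intervals vanish, so \<open>width a\<close> stays continuous below \<open>a\<close>; this lets the two
  distance estimates hold on the whole domain.
\<close>

lemma width_eq_0: "width a t = 0" if "t \<le> a"
  using that by (cases "t = a") (auto simp: width_def)

lemma has_real_derivative_width:
  assumes "0 < a" "a < t" "t < 1"
  shows "(width a has_real_derivative 1 / g t) (at t)"
proof -
  have "(width a has_real_derivative 1 / g t) (at t within {a..1})"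
    using integral_has_real_derivative[OF continuous_on_inverse_g[OF assms(1)], of t] assms
    by (simp add: width_def[abs_def])
  then show ?thesis
    using assms by (simp add: at_within_Icc_at)
qed

lemma has_real_derivative_f_line:
  assumes "y \<in> B"
  shows "((\<lambda>s. f (y + s *\<^sub>R v)) has_real_derivative G y \<bullet> v) (at 0)"
proof -
  have "((\<lambda>s. y + s *\<^sub>R v) has_derivative (\<lambda>s. s *\<^sub>R v)) (at 0)"
    by (auto intro!: derivative_eq_intros)
  moreover have "(f has_derivative (\<lambda>v. G y \<bullet> v)) (at (y + 0 *\<^sub>R v))"
    using deriv_f[OF assms] by simp
  ultimately have "((\<lambda>s. f (y + s *\<^sub>R v)) has_derivative (\<lambda>s. G y \<bullet> (s *\<^sub>R v))) (at 0)"
    by (rule has_derivative_compose)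
  then show ?thesis
    by (simp add: has_field_derivative_def mult.commute[of _ "G y \<bullet> v"] mult_commute_abs)
qed

lemma has_real_derivative_width_line:
  assumes "y \<in> B" "0 < a" "a < f y"
  shows "((\<lambda>s. width a (f (y + s *\<^sub>R v))) has_real_derivative (G y \<bullet> v) / g (f y)) (at 0)"
proof -
  have "(width a has_real_derivative 1 / g (f y)) (at (f (y + 0 *\<^sub>R v)))"
    using has_real_derivative_width[OF assms(2,3) f_less_1[OF assms(1)]] by simp
  from DERIV_chain2[OF this has_real_derivative_f_line[OF assms(1)]] show ?thesis
    by simp
qed

lemma eventually_line:
  assumes "y \<in> B" "a < f y"
  shows "\<forall>\<^sub>F s in at_right 0. y + s *\<^sub>R v \<in> B \<and> a < f (y + s *\<^sub>R v)"
proof -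
  have lim: "((\<lambda>s. y + s *\<^sub>R v) \<longlongrightarrow> y) (at_right 0)"
    by (auto intro!: tendsto_eq_intros)
  have "\<forall>\<^sub>F s in at_right 0. y + s *\<^sub>R v \<in> B"
    using lim open_B assms(1) by (rule topological_tendstoD)
  moreover have "\<forall>\<^sub>F s in at_right 0. a < f (y + s *\<^sub>R v)"
    using isCont_tendsto_compose[OF isCont_f[OF assms(1)] lim] assms(2)
    by (rule order_tendstoD(1))
  ultimately show ?thesis by eventually_elim auto
qed

text \<open>
  Replacing the slope \<open>1\<close> by \<open>c < 1\<close> makes the descent along \<open>- G\<close> strict, and avoids differentiating
  the distance: the triangle inequality bounds its change.
\<close>

lemma dist_le_width:
  assumes x: "x \<in> B" and a: "0 < a"
    and D: "\<And>y. y \<in> B \<Longrightarrow> f y \<le> a \<Longrightarrow> dist P y \<le> D"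
  shows "dist P x \<le> width a (f x) + D"
proof (cases "f x \<le> a")
  case True
  then show ?thesis using D[OF x] by (simp add: width_eq_0)
next
  case False
  define K where "K = {y \<in> closure B. a \<le> f y \<and> f y \<le> f x}"
  have K: "compact K" "x \<in> K"
    using compact_f_between False x closure_subset by (auto simp: K_def)
  have KB: "K \<subseteq> B"
    using in_B_if_less_1 f_less_1[OF x] by (force simp: K_def)
  have D0: "0 \<le> D"
    using D[OF P_in_B] f_eq_0_iff[of P] P_in_B closure_subset[of B] a by force
  have ineq: "c * dist P x \<le> width a (f x) + D" if c: "0 < c" "c < 1" for c
  proof -
    define \<phi> where "\<phi> y = width a (f y) - c * dist P y" for y
    have "continuous_on K (\<lambda>y. width a (f y))"
      using f_less_1 KB
      by (intro continuous_on_compose2[OF continuous_on_width[OF a]]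
            continuous_on_subset[OF cont_f]) (force simp: K_def)+
    then have "continuous_on K \<phi>"
      unfolding \<phi>_def by (intro continuous_intros)
    then obtain y where y: "y \<in> K" and min: "\<And>z. z \<in> K \<Longrightarrow> \<phi> y \<le> \<phi> z"
      using continuous_attains_inf[of K \<phi>] K by blast
    have yB: "y \<in> B" using y KB by auto
    have "f y = a"
    proof (rule ccontr)
      assume "f y \<noteq> a"
      with y have ay: "a < f y" by (auto simp: K_def)
      \<comment> \<open>\<open>N\<close> is the unit vector \<open>- \<nabla>u\<close>; a short step along it contradicts minimality.\<close>
      define N where "N = (- (1 / g (f y))) *\<^sub>R G y"
      have gy: "0 < g (f y)"
        using g_pos[of "f y"] ay a f_less_1[OF yB] by auto
      have nG: "norm (G y) = g (f y)"
        using norm_G[of y] f_eq_0_iff[of y] y ay a by (auto simp: K_def)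
      have GN: "G y \<bullet> N = - g (f y)"
        using gy nG by (simp add: N_def dot_square_norm power2_eq_square)
      have nN: "norm N = 1"
        using gy nG by (simp add: N_def)
      have "((\<lambda>s. width a (f (y + s *\<^sub>R N)) + c * s) has_real_derivative -1 + c) (at 0)"
        using gy has_real_derivative_width_line[OF yB a ay, of N]
        by (auto intro!: derivative_eq_intros simp: GN)
      then have e1: "\<forall>\<^sub>F s in at_right 0. width a (f (y + s *\<^sub>R N)) + c * s < width a (f y)"
        using DERIV_neg_dec_right[of "\<lambda>s. width a (f (y + s *\<^sub>R N)) + c * s" "-1 + c" 0] c
        unfolding eventually_at_right_field by force
      have e2: "\<forall>\<^sub>F s in at_right 0. f (y + s *\<^sub>R N) < f y"
        using DERIV_neg_dec_right[OF has_real_derivative_f_line[OF yB, of N]] gy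
        unfolding eventually_at_right_field GN by force
      have "\<forall>\<^sub>F s in at_right (0::real). 0 < s"
        by (simp add: eventually_at_right_less)
      with e1 e2 eventually_line[OF yB ay, of N] have "\<forall>\<^sub>F s in at_right (0::real). False"
      proof eventually_elim
        case (elim s)
        then have "y + s *\<^sub>R N \<in> K"
          using y closure_subset[of B] by (auto simp: K_def)
        from min[OF this] have "width a (f y) - c * dist P y
            \<le> width a (f (y + s *\<^sub>R N)) - c * dist P (y + s *\<^sub>R N)"
          by (simp add: \<phi>_def)
        moreover have "dist P y \<le> dist P (y + s *\<^sub>R N) + s"
          using dist_triangle[of P y "y + s *\<^sub>R N"] elim nN by (simp add: dist_norm)
        then have "c * dist P y \<le> c * (dist P (y + s *\<^sub>R N) + s)"
          using c by simp
        ultimately show False using elim by (simp add: algebra_simps)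
      qed
      then show False by simp
    qed
    then have "c * dist P y \<le> 1 * D"
      using D[OF yB] c D0 by (intro mult_mono) auto
    moreover have "\<phi> y = - c * dist P y"
      using \<open>f y = a\<close> by (simp add: \<phi>_def width_eq_0)
    ultimately show ?thesis
      using min[OF K(2)] by (simp add: \<phi>_def)
  qed
  show ?thesis
    by (rule field_le_mult_one_interval) (use ineq in auto)
qed

text \<open>
  Points of \<open>{a \<le> f \<le> f x}\<close> cannot in general be moved towards \<open>P\<close> within this set, since nothing is known
  about the shape of the sublevel sets. The ball about \<open>P\<close> whose radius is the distance to the level
  set of \<open>x\<close> is contained in the sublevel set, being connected and disjoint from its frontier;
  within this ball the move is possible. The bound obtained for the nearest point \<open>z\<close> of the level
  set then holds for \<open>x\<close>.
\<close>

lemma width_le_dist: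
  assumes x: "x \<in> B" and a: "0 < a"
  shows "width a (f x) \<le> dist P x"
proof (cases "f x \<le> a")
  case True
  then show ?thesis by (simp add: width_eq_0)
next
  case False
  define t where "t = f x"
  have t: "a < t" "t < 1" using False f_less_1[OF x] by (auto simp: t_def)
  define L where "L = {y \<in> closure B. t \<le> f y \<and> f y \<le> t}"
  have "compact L" "x \<in> L"
    using compact_f_between x closure_subset by (auto simp: L_def t_def)
  then obtain z where z: "z \<in> L" and zmin: "\<And>y. y \<in> L \<Longrightarrow> dist P z \<le> dist P y"
    using continuous_attains_inf[of L "dist P"]
      continuous_on_dist[OF continuous_on_const continuous_on_id, of L P] by blast
  define r where "r = dist P z"
  have r0: "0 < r"
    using z f_eq_0_iff[of z] t a by (auto simp: r_def L_def)
  define W where "W = B \<inter> f -` {..<t}"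
  have "open W"
    unfolding W_def using open_B isCont_f
    by (intro continuous_open_preimage) (auto intro: continuous_at_imp_continuous_on)
  have W_L: "frontier W \<subseteq> L"
  proof
    fix y assume "y \<in> frontier W"
    then have y: "y \<in> closure W" "y \<notin> W"
      using \<open>open W\<close> by (auto simp: frontier_def interior_open)
    have yB: "y \<in> closure B" using y(1) closure_mono[of W B] by (auto simp: W_def)
    have "f y \<le> t"
    proof (rule continuous_le_on_closure[OF _ y(1)])
      show "continuous_on (closure W) f"
        using closure_mono[of W B]
        by (intro continuous_on_subset[OF cont_f]) (auto simp: W_def)
    qed (auto simp: W_def)
    moreover have "\<not> f y < t"
      using y(2) in_B_if_less_1[OF yB] t by (auto simp: W_def)
    ultimately show "y \<in> L" using yB by (auto simp: L_def)
  qed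
  have ball_W: "ball P r \<subseteq> W"
  proof (rule ccontr)
    assume "\<not> ball P r \<subseteq> W"
    moreover have "P \<in> ball P r \<inter> W"
      using r0 P_in_B t a f_eq_0_iff[of P] closure_subset[of B] by (auto simp: W_def)
    ultimately have "ball P r \<inter> frontier W \<noteq> {}"
      using connected_Int_frontier[OF connected_ball, of P r W] by blast
    then show False using W_L zmin by (force simp: r_def)
  qed
  define K where "K = cball P r \<inter> {y \<in> closure B. a \<le> f y \<and> f y \<le> t}"
  have K: "compact K" "z \<in> K"
    using compact_f_between z t by (auto simp: K_def L_def r_def intro!: compact_Int)
  have KB: "K \<subseteq> B"
    using in_B_if_less_1 t by (force simp: K_def)
  have ineq: "width a t \<le> c * r" if c: "1 < c" for c
  proof -
    define \<phi> where "\<phi> y = width a (f y) - c * dist P y" for y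
    have "continuous_on K (\<lambda>y. width a (f y))"
      using f_less_1 KB
      by (intro continuous_on_compose2[OF continuous_on_width[OF a]]
            continuous_on_subset[OF cont_f]) (force simp: K_def)+
    then have "continuous_on K \<phi>"
      unfolding \<phi>_def by (intro continuous_intros)
    then obtain y where y: "y \<in> K" and max: "\<And>z. z \<in> K \<Longrightarrow> \<phi> z \<le> \<phi> y"
      using continuous_attains_sup[of K \<phi>] K by blast
    have yB: "y \<in> B" using y KB by auto
    have "f y = a"
    proof (rule ccontr)
      assume "f y \<noteq> a"
      with y have ay: "a < f y" by (auto simp: K_def)
      have yP: "y \<noteq> P" using ay a f_eq_0_iff[of P] P_in_B closure_subset[of B] by auto
      \<comment> \<open>A short step towards \<open>P\<close> contradicts maximality.\<close>
      define N where "N = (1 / dist P y) *\<^sub>R (P - y)"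
      have gy: "0 < g (f y)"
        using g_pos[of "f y"] ay a f_less_1[OF yB] by auto
      have nG: "norm (G y) = g (f y)"
        using norm_G[of y] yP y by (auto simp: K_def)
      have nN: "norm N = 1"
        using yP by (simp add: N_def dist_norm)
      have "\<bar>G y \<bullet> N\<bar> \<le> g (f y)"
        using Cauchy_Schwarz_ineq2[of "G y" N] nN nG by simp
      then have slope: "- 1 \<le> G y \<bullet> N / g (f y)"
        using gy by (simp add: field_simps)
      have "((\<lambda>s. width a (f (y + s *\<^sub>R N)) + c * s) has_real_derivative
               G y \<bullet> N / g (f y) + c) (at 0)"
        using has_real_derivative_width_line[OF yB a ay, of N]
        by (auto intro!: derivative_eq_intros)
      then have e1: "\<forall>\<^sub>F s in at_right 0. width a (f y) < width a (f (y + s *\<^sub>R N)) + c * s"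
        using DERIV_pos_inc_right[of "\<lambda>s. width a (f (y + s *\<^sub>R N)) + c * s"
            "G y \<bullet> N / g (f y) + c" 0] c slope
        unfolding eventually_at_right_field by force
      have e2: "\<forall>\<^sub>F s in at_right 0. s < dist P y"
        using yP by (intro order_tendstoD(2)[of "\<lambda>s. s" 0]) auto
      have "\<forall>\<^sub>F s in at_right (0::real). 0 < s"
        by (simp add: eventually_at_right_less)
      with e1 e2 eventually_line[OF yB ay, of N] have "\<forall>\<^sub>F s in at_right (0::real). False"
      proof eventually_elim
        case (elim s)
        have "P - (y + s *\<^sub>R N) = (1 - s / dist P y) *\<^sub>R (P - y)"
          by (simp add: N_def algebra_simps)
        then have "dist P (y + s *\<^sub>R N) = \<bar>1 - s / dist P y\<bar> * dist P y"
          by (simp add: dist_norm)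
        also have "\<dots> = dist P y - s"
          using elim yP by (simp add: field_simps abs_if)
        finally have ds: "dist P (y + s *\<^sub>R N) = dist P y - s" .
        have "y + s *\<^sub>R N \<in> ball P r"
          using ds elim y by (simp add: K_def)
        then have "f (y + s *\<^sub>R N) < t" using ball_W by (auto simp: W_def)
        then have "y + s *\<^sub>R N \<in> K"
          using elim ds y closure_subset[of B] by (auto simp: K_def)
        from max[OF this] show False
          using elim by (simp add: \<phi>_def ds algebra_simps)
      qed
      then show False by simp
    qed
    then have "\<phi> y \<le> 0"
      using c by (simp add: \<phi>_def width_eq_0)
    moreover have "f z = t" using z by (simp add: L_def)
    ultimately show ?thesis
      using max[OF K(2)] by (simp add: \<phi>_def r_def)
  qed
  have "width a t / r \<le> 1"
    by (rule dense_ge) (use ineq r0 in \<open>auto simp: field_simps\<close>)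
  then have "width a t \<le> r" using r0 by simp
  then show ?thesis
    using zmin[OF \<open>x \<in> L\<close>] by (simp add: r_def t_def)
qed

lemma sublevel_subset_cball:
  assumes "0 < e"
  obtains a where "0 < a" "a < 1" "\<And>y. y \<in> B \<Longrightarrow> f y \<le> a \<Longrightarrow> dist P y \<le> e"
proof -
  define K where "K = closure B - ball P e"
  have "compact K"
    unfolding K_def using compact_closure_B by (rule compact_diff) simp
  show ?thesis
  proof (cases "K = {}")
    case True
    then show ?thesis using that[of "1/2"] closure_subset[of B] by (force simp: K_def)
  next
    case False
    moreover have "continuous_on K f"
      by (rule continuous_on_subset[OF cont_f]) (auto simp: K_def)
    ultimately obtain z where z: "z \<in> K" "\<And>y. y \<in> K \<Longrightarrow> f z \<le> f y"
      using continuous_attains_inf[OF \<open>compact K\<close>] by blast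
    have "0 < f z"
      using z(1) f_range(1)[of z] f_eq_0_iff[of z] \<open>0 < e\<close> by (force simp: K_def)
    moreover have "f z \<le> 1" using z(1) f_range(2) by (auto simp: K_def)
    moreover have "dist P y \<le> e" if "y \<in> B" "f y \<le> f z / 2" for y
      using z(2)[of y] that \<open>0 < f z\<close> closure_subset[of B] by (force simp: K_def)
    ultimately show ?thesis using that[of "f z / 2"] by simp
  qed
qed

lemma dist_frontier_le:
  assumes x: "x \<in> frontier B" and y: "y \<in> frontier B"
  shows "dist P x \<le> dist P y"
proof (rule field_le_epsilon)
  fix e :: real assume "0 < e"
  then obtain a where a: "0 < a" "a < 1" and D: "\<And>z. z \<in> B \<Longrightarrow> f z \<le> a \<Longrightarrow> dist P z \<le> e"
    using sublevel_subset_cball by blast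
  \<comment> \<open>Truncating at \<open>a\<close> keeps the argument where \<open>width a\<close> is known to be continuous.\<close>
  define u where "u z = width a (max a (f z))" for z
  have u: "u z = width a (f z)" for z
    by (auto simp: u_def max_def width_eq_0)
  have "continuous_on (closure B) u"
    unfolding u_def using f_range(2) a
    by (intro continuous_on_compose2[OF continuous_on_width[OF a(1)]] continuous_intros cont_f) auto
  then have *: "continuous_on (closure B) (\<lambda>z. dist P z - u z)"
    by (intro continuous_intros)
  have cl: "x \<in> closure B" "y \<in> closure B" using x y by (auto simp: frontier_def)
  have "dist P x - u x \<le> e"
    using dist_le_width[OF _ a(1) D]
    by (intro continuous_le_on_closure[OF * cl(1)]) (simp add: u algebra_simps)
  moreover have "0 \<le> dist P y - u y"
    using width_le_dist[OF _ a(1)]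
    by (intro continuous_ge_on_closure[OF * cl(2)]) (simp add: u)
  moreover have "u x = u y"
    using x y cl f_eq_1_iff[of x] f_eq_1_iff[of y] by (simp add: u)
  ultimately show "dist P x \<le> dist P y + e" by simp
qed

end

section \<open>Spherical boundaries and Jordan domains\<close>

lemma open_eq_ball_if_frontier_subset_sphere:
  fixes B :: "'a::euclidean_space set"
  assumes "2 \<le> DIM('a)" "open B" "bounded B" "P \<in> B" "0 < r" "frontier B \<subseteq> sphere P r"
  shows "B = ball P r"
proof
  show sub: "ball P r \<subseteq> B"
  proof (rule ccontr)
    assume "\<not> ball P r \<subseteq> B"
    moreover have "P \<in> ball P r \<inter> B"
      using assms by simp
    ultimately have "ball P r \<inter> frontier B \<noteq> {}"
      using connected_Int_frontier[OF connected_ball, of P r B] by blast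
    then show False using assms(6) by auto
  qed
  have "connected (- cball P r)"
    using assms(1) by (intro connected_complement_bounded_convex) auto
  moreover have "\<not> - cball P r \<subseteq> B"
    using assms(3) cobounded_imp_unbounded[of "- cball P r"] bounded_subset by auto
  moreover have "- cball P r \<inter> frontier B = {}"
    using assms(6) by auto
  ultimately have "- cball P r \<inter> B = {}"
    using connected_Int_frontier[of "- cball P r" B] by blast
  then have "B \<subseteq> interior (cball P r)"
    using assms(2) by (intro interior_maximal) auto
  then show "B \<subseteq> ball P r" by (simp add: interior_cball)
qed

lemma has_derivative_gradient:
  fixes f :: "real^'n \<Rightarrow> real"
  assumes "f differentiable_on S" "x \<in> interior S"
  shows "(f has_derivative (\<lambda>v. gradient f S x \<bullet> v)) (at x)"
proof -
  let ?D = "frechet_derivative f (at x within S)"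
  have at: "at x within S = at x" using assms(2) by (rule at_within_interior)
  have D: "(f has_derivative ?D) (at x)"
    using assms interior_subset[of S] frechet_derivative_works[of f "at x within S"] at
    by (metis differentiable_on_def subsetD)
  then have lin: "linear ?D" by (rule has_derivative_linear)
  have "?D v = gradient f S x \<bullet> v" for v
  proof -
    have "?D v = ?D (\<Sum>i\<in>UNIV. v $ i *\<^sub>R axis i 1)"
      by (simp add: basis_expansion flip: scalar_mult_eq_scaleR)
    also have "\<dots> = (\<Sum>i\<in>UNIV. v $ i * ?D (axis i 1))"
      using lin by (simp add: linear_sum linear_cmul)
    also have "\<dots> = gradient f S x \<bullet> v"
      by (simp add: gradient_def inner_vec_def mult.commute)
    finally show ?thesis .
  qed
  then have "?D = (\<lambda>v. gradient f S x \<bullet> v)" by auto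
  with D show ?thesis by simp
qed

lemma frontier_Jordan_domain:
  assumes "simple_path c" "pathfinish c = pathstart c" "B \<in> components (- path_image c)"
  shows "frontier B = path_image (c :: real \<Rightarrow> real^2)"
proof (rule Jordan_Brouwer_frontier[OF _ assms(3)])
  have "path_image c homeomorphic sphere (0::complex) 1"
    using assms by (intro homeomorphic_simple_path_image_circle) auto
  also have "sphere (0::complex) 1 homeomorphic sphere (0 :: real^2) 1"
    by (rule homeomorphic_spheres_gen) auto
  finally show "path_image c homeomorphic sphere (0 :: real^2) 1" .
qed simp

section \<open>Circles\<close>

theorem mainTheorem3:
  fixes C R :: "(real^2) set" and P :: "real^2" and f :: "real^2 \<Rightarrow> real"
  assumes "C2_simple_closed_curve C"
    and "bounds_Jordan_domain C R"
    and "P \<in> interior R"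
    and "f ` R \<subseteq> {0..1}"
    and "morse_on R f"
    and "{x \<in> R. f x = 0} = {P}"
    and "{x \<in> R. f x = 1} = C"
    and "\<And>t. t \<in> {0<..1} \<Longrightarrow> simple_closed_curve {x \<in> R. f x = t}"
    and "\<And>t. t \<in> {0<..1} \<Longrightarrow> \<exists>k>0. \<forall>x\<in>{x \<in> R. f x = t}. norm (gradient f R x) = k"
  shows "\<exists>a r. r > 0 \<and> C = sphere a r"
proof -
  obtain c where c: "\<And>s. c (s + 1) = c s" "simple_path c" "path_image c = C"
    using assms(1) by (auto simp: C2_simple_closed_curve_def)
  have closed_c: "pathfinish c = pathstart c"
    using c(1)[of 0] by (simp add: pathfinish_def pathstart_def)
  obtain B where B: "B \<in> components (- C)" "bounded B" "R = C \<union> B"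
    using assms(2) by (auto simp: bounds_Jordan_domain_def)
  have fr: "frontier B = C"
    using frontier_Jordan_domain[OF c(2) closed_c] B c(3) by simp
  have "closed C" using fr by auto
  then have "open B" using B(1) open_components by blast
  have clB: "closure B = R"
    using B(3) fr closure_Un_frontier[of B] by auto
  have "P \<in> R" "f P = 0" using assms(6) by auto
  then have "P \<in> B" using assms(7) B(3) by force
  obtain g where g: "\<And>t. t \<in> {0<..1} \<Longrightarrow> 0 < g t"
      "\<And>t x. t \<in> {0<..1} \<Longrightarrow> x \<in> R \<Longrightarrow> f x = t \<Longrightarrow> norm (gradient f R x) = g t"
    using assms(9) by simp metis
  have C2: "f differentiable_on R" "gradient f R differentiable_on R"
    using assms(5) by (auto simp: morse_on_def C2_on_def)
  have "B \<subseteq> interior R" using \<open>open B\<close> B(3) by (simp add: interior_maximal)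
  interpret transnormal B P f "gradient f R" g
  proof
    show "f ` closure B = {0..1}"
    proof
      show "{0..1} \<subseteq> f ` closure B"
      proof
        fix t :: real assume t: "t \<in> {0..1}"
        show "t \<in> f ` closure B"
        proof (cases "t = 0")
          case False
          with t have "simple_closed_curve {x \<in> R. f x = t}" using assms(8) by simp
          then have "{x \<in> R. f x = t} \<noteq> {}"
            unfolding simple_closed_curve_def using path_image_nonempty by metis
          then show ?thesis using clB by auto
        qed (use \<open>P \<in> R\<close> \<open>f P = 0\<close> clB in force)
      qed
    qed (use assms(4) clB in simp)
    show "norm (gradient f R x) = g (f x)" if "x \<in> closure B" "x \<noteq> P" for x
    proof (rule g(2))
      have "f x \<noteq> 0" "f x \<in> {0..1}" using that clB assms(4,6) by auto
      then show "f x \<in> {0<..1}" by auto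
    qed (use that clB in auto)
    show "(f has_derivative (\<lambda>v. gradient f R x \<bullet> v)) (at x)" if "x \<in> B" for x
      using has_derivative_gradient[OF C2(1)] that \<open>B \<subseteq> interior R\<close> by blast
  qed (use \<open>open B\<close> B(2) \<open>P \<in> B\<close> C2 clB fr assms(6,7) g(1) in
       \<open>auto intro: differentiable_imp_continuous_on\<close>)
  obtain q where q: "q \<in> C" using path_image_nonempty[of c] c(3) by auto
  define r where "r = dist P q"
  have "frontier B \<subseteq> sphere P r"
    using dist_frontier_le q fr by (auto simp: r_def intro!: antisym)
  moreover have "0 < r"
    using q \<open>f P = 0\<close> assms(7) by (auto simp: r_def)
  ultimately have "B = ball P r"
    using \<open>open B\<close> B(2) \<open>P \<in> B\<close> by (intro open_eq_ball_if_frontier_subset_sphere) auto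
  with fr \<open>0 < r\<close> show ?thesis by auto
qed

end
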